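(* Let $m\geqslant 1$ be an integer, $p$ an odd prime, $b\geqslant 2$ an integer coprime to $p$, and let $q_j$ and $r_j$ be given by the base-$b$ algorithm for the reduced fraction $a/p^m$ with $0<a/p^m<1$. If $b$ is a primitive root of $p$ and of $p^2$, then the base-$b$ expansion of $a/p^m$ has (minimal) period length $\varphi(p^m)$, and $$\#\left\{j: 1\leqslant j\leqslant \varphi(p^m),\ q_j=0\right\}=\left\lfloor\frac{p^m}{b}\right\rfloor-\left\lfloor\frac{p^{m-1}}{b}\right\rfloor.$$
   Context: Base-$b$ algorithm for $a/k<1$: let $b,k\geqslant 2$ be integers and $a\geqslant 1$ an integer coprime to $k$ with $a<k$. Set $r_0=a$ and, for $j=1,2,\ldots$, define $q_j\in\{0,1,\ldots,b-1\}$ and $r_j\in\{0,1,\ldots,k-1\}$ by division with remainder $r_{j-1}b=q_jk+r_j$. Stop at the first $n\geqslant 1$ with $r_n=r_0$ (such $n$ exists when $\gcd(b,k)=1$); then the base-$b$ expansion of $a/k$ is the purely periodic expansion $0.\overline{q_1q_2\cdots q_n}$. Here $\varphi$ is Euler's totient function, and the algorithm is applied with $k=p^m$. *)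

theory Defs
  imports Complex_Main "HOL-Number_Theory.Residue_Primitive_Roots"
begin

text \<open>
  The base-\<open>b\<close> algorithm for \<open>a / k\<close>: \<open>base_rem b a k j\<close> is \<open>r\<^sub>j\<close> and \<open>base_quot b a k j\<close> is
  \<open>q\<^sub>j\<close>. Both are defined beyond the stopping index as well, where they repeat cyclically. The
  quotients are indexed from 1; the value of \<open>base_quot\<close> at 0 is irrelevant.
\<close>

fun base_rem :: "nat \<Rightarrow> nat \<Rightarrow> nat \<Rightarrow> nat \<Rightarrow> nat" where
  "base_rem b a k 0 = a"
| "base_rem b a k (Suc j) = (base_rem b a k j * b) mod k"

definition base_quot :: "nat \<Rightarrow> nat \<Rightarrow> nat \<Rightarrow> nat \<Rightarrow> nat" where
  "base_quot b a k j = (base_rem b a k (j - 1) * b) div k"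

definition base_algorithm_stops_at :: "nat \<Rightarrow> nat \<Rightarrow> nat \<Rightarrow> nat \<Rightarrow> bool" where
  "base_algorithm_stops_at b a k n \<longleftrightarrow>
     n \<ge> 1 \<and> base_rem b a k n = base_rem b a k 0 \<and>
     (\<forall>j. 1 \<le> j \<and> j < n \<longrightarrow> base_rem b a k j \<noteq> base_rem b a k 0)"

lemma base_algorithm_division:
  assumes "a < k" and "b \<ge> 1" and "j \<ge> 1"
  shows "base_rem b a k (j - 1) * b = base_quot b a k j * k + base_rem b a k j"
    and "base_rem b a k j < k"
    and "base_quot b a k j < b"
proof -
  obtain i where i: "j = Suc i"
    using assms(3) by (cases j) auto
  have rem: "base_rem b a k l < k" for l
    using assms(1) by (cases l) auto
  show "base_rem b a k (j - 1) * b = base_quot b a k j * k + base_rem b a k j"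
    by (simp add: i base_quot_def)
  show "base_rem b a k j < k"
    by (rule rem)
  have "base_rem b a k i * b < b * k"
    using rem[of i] assms(2) by (simp add: mult.commute)
  thus "base_quot b a k j < b"
    by (simp add: i base_quot_def less_mult_imp_div_less)
qed

text \<open>
  The \<open>j\<close>-th digit after the point (\<open>j \<ge> 1\<close>) in the base-\<open>b\<close> expansion of a real number
  \<open>x \<ge> 0\<close>; this is the usual expansion, without an infinite tail of digits \<open>b - 1\<close>.
\<close>

definition base_digit :: "nat \<Rightarrow> real \<Rightarrow> nat \<Rightarrow> int" where
  "base_digit b x j = \<lfloor>x * real b ^ j\<rfloor> mod int b"

definition purely_periodic_expansion :: "nat \<Rightarrow> real \<Rightarrow> nat \<Rightarrow> bool" where
  "purely_periodic_expansion b x n \<longleftrightarrow>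
     n \<ge> 1 \<and> (\<forall>j\<ge>1. base_digit b x (j + n) = base_digit b x j)"

definition has_minimal_period_length :: "nat \<Rightarrow> real \<Rightarrow> nat \<Rightarrow> bool" where
  "has_minimal_period_length b x n \<longleftrightarrow>
     purely_periodic_expansion b x n \<and>
     (\<forall>l. purely_periodic_expansion b x l \<longrightarrow> n \<le> l)"

end

theory Submission
  imports Defs
begin

text \<open>
  The remainders of the algorithm are \<open>r\<^sub>j = a b\<^sup>j mod k\<close>, so for \<open>a\<close> and \<open>b\<close> coprime to \<open>k\<close> they
  recur exactly with period \<open>ord k b\<close> (\<open>base_rem_eq_iff\<close>). The quotients are the digits of \<open>a / k\<close>
  (\<open>base_digit_fraction\<close>), and the infinite digit sequence determines the remainder from which it
  starts (\<open>base_rem_start_unique\<close>); hence the digits have no shorter period than the remainders.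

  A primitive root modulo both \<open>p\<close> and \<open>p\<^sup>2\<close> is one modulo every \<open>p\<^sup>m\<close>, so that here the order is
  \<open>totient (p\<^sup>m)\<close>. Over one period the remainders then run exactly once through all residues coprime to
  \<open>p\<^sup>m\<close>. The digit produced from a remainder \<open>x\<close> is zero iff \<open>x b < p\<^sup>m\<close>, which turns the number of zero
  digits into the number of \<open>x\<close> with \<open>0 < x < p\<^sup>m / b\<close> and \<open>p\<close> not dividing \<open>x\<close>. There are
  \<open>\<lfloor>p\<^sup>m / b\<rfloor>\<close> positive integers below \<open>p\<^sup>m / b\<close>, and the multiples of \<open>p\<close> among them are the \<open>p y\<close> with
  \<open>0 < y < p\<^sup>m\<^sup>-\<^sup>1 / b\<close>; both counts use that \<open>b\<close>, being at least 2 and coprime to \<open>p\<close>, divides no power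
  of \<open>p\<close>.
\<close>

section \<open>Recurrence of the remainders\<close>

lemma base_rem_closed_form:
  assumes "a < k"
  shows "base_rem b a k j = a * b ^ j mod k"
proof (induction j)
  case 0
  then show ?case using assms by simp
next
  case (Suc j)
  have "base_rem b a k (Suc j) = (a * b ^ j mod k) * b mod k"
    by (simp add: Suc)
  also have "\<dots> = a * b ^ Suc j mod k"
    by (simp only: mod_mult_right_eq power_Suc mult_ac)
  finally show ?case .
qed

lemma base_rem_less: "a < k \<Longrightarrow> base_rem b a k j < k"
  by (simp add: base_rem_closed_form)

text \<open>After \<open>i\<close> steps the algorithm continues as if it had been started at \<open>r\<^sub>i\<close>.\<close>
lemma base_rem_add: "base_rem b a k (i + j) = base_rem b (base_rem b a k i) k j"
  by (induction j) auto

lemma base_quot_add: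
  assumes "j \<ge> 1"
  shows "base_quot b a k (i + j) = base_quot b (base_rem b a k i) k j"
  using assms by (cases j) (simp_all add: base_quot_def base_rem_add)

lemma base_rem_eq_iff:
  assumes "a < k" and "coprime a k" and "coprime k b"
  shows "base_rem b a k i = base_rem b a k j \<longleftrightarrow> [i = j] (mod ord k b)"
proof -
  have "base_rem b a k i = base_rem b a k j \<longleftrightarrow> [a * b ^ i = a * b ^ j] (mod k)"
    using assms(1) by (simp add: base_rem_closed_form cong_def)
  also have "\<dots> \<longleftrightarrow> [b ^ i = b ^ j] (mod k)"
    using assms(2) by (rule cong_mult_lcancel_nat)
  also have "\<dots> \<longleftrightarrow> [i = j] (mod ord k b)"
    using assms(3) by (rule order_divides_expdiff)
  finally show ?thesis .
qed

lemma base_algorithm_stops_at_ord: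
  assumes "a < k" and "coprime a k" and "coprime k b"
  shows "base_algorithm_stops_at b a k (ord k b)"
proof -
  have "ord k b \<ge> 1"
    using assms(3) by (simp add: Suc_le_eq)
  moreover have "base_rem b a k j = base_rem b a k 0 \<longleftrightarrow> ord k b dvd j" for j
    by (subst base_rem_eq_iff[OF assms]) (simp add: cong_0_iff)
  ultimately show ?thesis
    unfolding base_algorithm_stops_at_def by (auto dest: dvd_imp_le)
qed

section \<open>Quotients and digits\<close>

lemma base_digit_fraction:
  assumes "a < k" and "b \<ge> 1" and "j \<ge> 1"
  shows "base_digit b (real a / real k) j = int (base_quot b a k j)"
proof -
  obtain i where i: "j = Suc i"
    using assms(3) by (cases j) auto
  define c where "c = a * b ^ i"
  \<comment> \<open>Modulo \<open>b\<close>, only the part of \<open>c\<close> left over by division by \<open>k\<close> contributes to the digit,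
    and that part is the current remainder of the algorithm.\<close>
  have "c * b = (c div k * b) * k + (c mod k) * b"
    by (metis div_mult_mod_eq distrib_right mult.assoc mult.commute)
  hence "c * b div k = c div k * b + (c mod k) * b div k"
    using assms(1) by simp
  moreover have "(c mod k) * b div k = base_quot b a k j"
    using assms(1) by (simp add: i c_def base_quot_def base_rem_closed_form)
  ultimately have "c * b div k mod b = base_quot b a k j mod b"
    by simp
  also have "\<dots> = base_quot b a k j"
    using base_algorithm_division(3)[OF assms] by simp
  finally have "c * b div k mod b = base_quot b a k j" .
  moreover have "\<lfloor>real a / real k * real b ^ j\<rfloor> = int (c * b div k)"
    using floor_divide_of_nat_eq[of "c * b" k, where ?'a = real]
    by (simp add: i c_def mult_ac)
  ultimately show ?thesis
    by (simp add: base_digit_def flip: zmod_int)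
qed

text \<open>
  As long as the quotients agree, each step multiplies the difference of the two remainders by \<open>b\<close>.
  The difference always stays below \<open>k\<close> in absolute value, so it must be zero from the start.
\<close>
lemma base_rem_start_unique:
  assumes "r < k" and "s < k" and "b \<ge> 2"
    and eq: "\<And>j. j \<ge> 1 \<Longrightarrow> base_quot b r k j = base_quot b s k j"
  shows "r = s"
proof (rule ccontr)
  assume "r \<noteq> s"
  have diff: "int (base_rem b r k n) - int (base_rem b s k n) = (int r - int s) * int b ^ n" for n
  proof (induction n)
    case (Suc n)
    have "int (base_rem b x k n) * int b =
        int (base_quot b x k (Suc n)) * int k + int (base_rem b x k (Suc n))" if "x < k" for x
      using base_algorithm_division(1)[of x k b "Suc n"] that assms(3)
      by (simp del: base_rem.simps flip: of_nat_mult of_nat_add)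
    from this[OF assms(1)] this[OF assms(2)] eq[of "Suc n"]
    have "int (base_rem b r k (Suc n)) - int (base_rem b s k (Suc n)) =
        (int (base_rem b r k n) - int (base_rem b s k n)) * int b"
      by (simp add: left_diff_distrib del: base_rem.simps)
    thus ?case
      by (simp add: Suc mult_ac del: base_rem.simps)
  qed simp
  \<comment> \<open>Any exponent \<open>n\<close> with \<open>b ^ n \<ge> k\<close> gives the contradiction; \<open>n = k\<close> is one.\<close>
  have "k < b ^ k"
    using assms(3) by (intro less_le_trans[OF less_exp power_mono]) auto
  have "int k \<le> int b ^ k"
    using \<open>k < b ^ k\<close> by (metis less_imp_le of_nat_le_iff of_nat_power)
  also have "\<dots> \<le> \<bar>int r - int s\<bar> * int b ^ k"
    using \<open>r \<noteq> s\<close> mult_right_mono[of 1 "\<bar>int r - int s\<bar>" "int b ^ k"] by simp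
  also have "\<dots> = \<bar>int (base_rem b r k k) - int (base_rem b s k k)\<bar>"
    by (simp add: diff abs_mult)
  also have "\<dots> < int k"
    using base_rem_less[OF assms(1), of b k] base_rem_less[OF assms(2), of b k] by linarith
  finally show False by simp
qed

lemma has_minimal_period_length_ord:
  assumes "a < k" and "coprime a k" and "coprime k b" and "b \<ge> 2"
  shows "has_minimal_period_length b (real a / real k) (ord k b)"
proof -
  have pos: "ord k b \<ge> 1"
    using assms(3) by (simp add: Suc_le_eq)
  have return: "base_rem b a k l = a \<longleftrightarrow> ord k b dvd l" for l
    using base_rem_eq_iff[OF assms(1-3), of l 0] by (simp add: cong_0_iff)
  have period_iff: "purely_periodic_expansion b (real a / real k) l \<longleftrightarrow>
      l \<ge> 1 \<and> ord k b dvd l" for l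
  proof -
    have "(\<forall>j\<ge>1. base_digit b (real a / real k) (j + l) = base_digit b (real a / real k) j) \<longleftrightarrow>
        (\<forall>j\<ge>1. base_quot b (base_rem b a k l) k j = base_quot b a k j)"
      using assms(1,4) base_quot_add[of _ b a k l]
      by (simp add: base_digit_fraction add.commute[of _ l])
    also have "\<dots> \<longleftrightarrow> base_rem b a k l = a"
      using base_rem_start_unique[OF base_rem_less[OF assms(1)] assms(1,4)] by metis
    finally show ?thesis
      by (simp add: purely_periodic_expansion_def return)
  qed
  show ?thesis
    unfolding has_minimal_period_length_def using pos by (auto simp: period_iff dest: dvd_imp_le)
qed

section \<open>Counting zero digits\<close>

text \<open>
  Since \<open>b\<close> has order \<open>totient k\<close>, no remainder repeats among the first \<open>totient k\<close>; all of them are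
  coprime to \<open>k\<close>, and there are only \<open>totient k\<close> residues of that kind.
\<close>
lemma bij_betw_base_rem_totatives:
  assumes "a < k" and "coprime a k" and "k > 1" and "residue_primroot k b"
  shows "bij_betw (base_rem b a k) {..<totient k} (totatives k)"
proof -
  have cop: "coprime k b" and ord: "ord k b = totient k"
    using assms(4) by (auto simp: residue_primroot_def)
  have inj: "inj_on (base_rem b a k) {..<totient k}"
    by (auto simp: inj_on_def base_rem_eq_iff[OF assms(1,2) cop] ord cong_less_modulus_unique_nat)
  have "base_rem b a k j \<in> totatives k" for j
  proof -
    have "coprime (base_rem b a k j) k"
      using assms(1,2) cop by (simp add: base_rem_closed_form coprime_commute)
    thus ?thesis
      using base_rem_less[OF assms(1), of b j] assms(3)
      by (auto simp: totatives_def intro!: Nat.gr0I)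
  qed
  hence "base_rem b a k ` {..<totient k} = totatives k"
    using inj by (intro card_subset_eq) (auto simp: card_image totient_def)
  with inj show ?thesis by (simp add: bij_betw_def)
qed

lemma card_zero_base_quot:
  assumes "a < k" and "coprime a k" and "k > 1" and "residue_primroot k b"
  shows "card {j. 1 \<le> j \<and> j \<le> totient k \<and> base_quot b a k j = 0} =
    card {x \<in> totatives k. x * b < k}"
proof -
  have "{j. 1 \<le> j \<and> j \<le> totient k \<and> base_quot b a k j = 0} =
      Suc ` {i \<in> {..<totient k}. base_rem b a k i * b < k}" (is "?Z = Suc ` ?I")
  proof (rule Set.set_eqI)
    fix j
    show "j \<in> ?Z \<longleftrightarrow> j \<in> Suc ` ?I"
      using assms(3) by (cases j) (auto simp: base_quot_def div_eq_0_iff)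
  qed
  hence "card ?Z = card ?I"
    by (simp add: card_image)
  also have "bij_betw (base_rem b a k) ?I {x \<in> totatives k. x * b < k}"
    using bij_betw_base_rem_totatives[OF assms]
    by (auto simp: bij_betw_def inj_on_def)
  hence "card ?I = card {x \<in> totatives k. x * b < k}"
    by (rule bij_betw_same_card)
  finally show ?thesis .
qed

lemma card_positive_multiples_below:
  assumes "b > 0" and "\<not> b dvd N"
  shows "card {x::nat. 0 < x \<and> x * b < N} = N div b"
proof -
  have below_iff: "x * b < N \<longleftrightarrow> x \<le> N div b" for x
  proof -
    have "x * b \<noteq> N" using assms(2) by auto
    thus ?thesis using assms(1) by (auto simp: less_eq_div_iff_mult_less_eq)
  qed
  have "{x. 0 < x \<and> x * b < N} = {0<..N div b}"
    unfolding below_iff by auto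
  thus ?thesis by simp
qed

text \<open>
  The numbers below \<open>p ^ Suc n / b\<close> that are not coprime to \<open>p\<close> are the \<open>p y\<close> with \<open>y\<close> below
  \<open>p ^ n / b\<close>. Both bounds have the form treated in the previous lemma. The identity is additive
  because subtraction of natural numbers truncates.
\<close>
lemma card_totatives_prime_power_below:
  assumes "prime p" and "b \<ge> 2" and "coprime b p"
  shows "card {x \<in> totatives (p ^ Suc n). x * b < p ^ Suc n} + p ^ n div b = p ^ Suc n div b"
proof -
  define below where "below N = {x::nat. 0 < x \<and> x * b < N}" for N
  have card_below: "card (below (p ^ i)) = p ^ i div b" for i
  proof -
    have "\<not> b dvd p ^ i"
    proof
      assume "b dvd p ^ i"
      moreover have "coprime b (p ^ i)" using assms(3) by simp
      ultimately have "b = 1" by (metis coprime_absorb_left nat_dvd_1_iff_1)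
      with assms(2) show False by simp
    qed
    thus ?thesis
      unfolding below_def using assms(2) by (intro card_positive_multiples_below) auto
  qed
  have le: "x \<le> x * b" for x using assms(2) by simp
  have fin: "finite (below N)" for N
    by (rule finite_subset[of _ "{..N}"]) (auto simp: below_def intro: le_trans[OF le less_imp_le])
  have "{x \<in> totatives (p ^ Suc n). x * b < p ^ Suc n} =
      below (p ^ Suc n) - (*) p ` below (p ^ n)"
  proof -
    have range: "x \<le> N" if "x * b < N" for x N
      using le[of x] that by linarith
    have "p * y * b < p ^ Suc n \<longleftrightarrow> y * b < p ^ n" for y
      using prime_gt_0_nat[OF assms(1)] by (simp add: mult.assoc)
    thus ?thesis
      by (auto simp: totatives_prime_power_Suc[OF assms(1)] below_def range simp del: power_Suc)
  qed
  moreover have "(*) p ` below (p ^ n) \<subseteq> below (p ^ Suc n)"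
    using prime_gt_0_nat[OF assms(1)] by (auto simp: below_def mult.assoc)
  moreover have "card ((*) p ` below (p ^ n)) = p ^ n div b"
    using prime_gt_0_nat[OF assms(1)] by (simp add: card_image inj_on_def card_below)
  ultimately show ?thesis
    using card_mono[OF fin, of "(*) p ` below (p ^ n)" "p ^ Suc n"]
    by (simp add: card_Diff_subset fin card_below del: power_Suc)
qed

theorem proposition2p8:
  fixes m p b a :: nat
  assumes "m \<ge> 1"
    and "prime p" and "odd p"
    and "b \<ge> 2" and "coprime b p"
    and "a \<ge> 1" and "a < p ^ m" and "coprime a (p ^ m)"
    and "residue_primroot p b" and "residue_primroot (p ^ 2) b"
  shows "has_minimal_period_length b (real a / real (p ^ m)) (totient (p ^ m)) \<and>
    base_algorithm_stops_at b a (p ^ m) (totient (p ^ m)) \<and>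
    int (card {j. 1 \<le> j \<and> j \<le> totient (p ^ m) \<and> base_quot b a (p ^ m) j = 0}) =
      \<lfloor>real (p ^ m) / real b\<rfloor> - \<lfloor>real (p ^ (m - 1)) / real b\<rfloor>"
proof -
  have "p > 1" using assms(2) by (rule prime_gt_1_nat)
  \<comment> \<open>The order of \<open>b\<close> modulo \<open>p\<^sup>2\<close> is \<open>p (p - 1)\<close>, which exceeds \<open>p - 1\<close>; this is what lets the
    primitive root lift to higher powers of \<open>p\<close>.\<close>
  have "\<not> totient (p ^ 2) dvd p - 1"
  proof
    assume "totient (p ^ 2) dvd p - 1"
    hence "p * (p - 1) \<le> p - 1"
      using \<open>p > 1\<close> totient_prime_power[OF assms(2), of 2] by (simp add: dvd_imp_le)
    thus False using \<open>p > 1\<close> by simp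
  qed
  hence "[b ^ (p - 1) \<noteq> 1] (mod p\<^sup>2)"
    using assms(10) by (simp add: ord_divides' residue_primroot_def)
  hence root: "residue_primroot (p ^ m) b"
    using residue_primroot_prime_lift_iff[OF assms(2,3,9)] assms(1) by simp
  hence cop: "coprime (p ^ m) b" and ord: "ord (p ^ m) b = totient (p ^ m)"
    by (auto simp: residue_primroot_def)
  have "p ^ m > 1" using assms(6,7) by linarith
  obtain n where m: "m = Suc n" using assms(1) by (cases m) auto
  have "card {j. 1 \<le> j \<and> j \<le> totient (p ^ m) \<and> base_quot b a (p ^ m) j = 0} + p ^ (m - 1) div b
      = p ^ m div b"
    unfolding card_zero_base_quot[OF assms(7,8) \<open>p ^ m > 1\<close> root]
    using card_totatives_prime_power_below[OF assms(2,4,5), of n] by (simp add: m)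
  hence "int (card {j. 1 \<le> j \<and> j \<le> totient (p ^ m) \<and> base_quot b a (p ^ m) j = 0}) =
      int (p ^ m div b) - int (p ^ (m - 1) div b)"
    by linarith
  also have "\<dots> = \<lfloor>real (p ^ m) / real b\<rfloor> - \<lfloor>real (p ^ (m - 1)) / real b\<rfloor>"
    by (simp only: floor_divide_of_nat_eq)
  finally show ?thesis
    using has_minimal_period_length_ord[OF assms(7,8) cop assms(4)]
      base_algorithm_stops_at_ord[OF assms(7,8) cop]
    by (simp add: ord)
qed

end
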